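(* (a) For every real $\lambda\in(1,2)$ there exists a $\lambda$-lacunary sequence of positive integers $(n_i)_{i=1}^{\infty}$ such that $P((1/n_i)_{i=1}^{\infty})\supseteq[0,2]\cap\mathbb{Q}$. (b) For every real $\lambda\in(1,2)$ the sequence in part (a) can be chosen with additional properties: there exists a $\lambda$-lacunary sequence of positive integers $(n_i)_{i=1}^{\infty}$ such that $P((1/n_i)_{i=1}^{\infty})\supseteq[0,2]\cap\mathbb{Q}$, such that $\lim_{i\to\infty} n_{i+1}/n_i=2$, and such that every rational number in $(0,2]$ is equal to $\sum_{i\in T}1/n_i$ for infinitely many finite sets $T\subset\mathbb{N}$. (c) There is no $2$-lacunary sequence of positive integers $(n_i)_{i=1}^{\infty}$ such that $P((1/n_i)_{i=1}^{\infty})$ contains all rational numbers from some non-empty open interval.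
   Context: $\mathbb{N}=\{1,2,3,\ldots\}$. For a real $\lambda>1$, a sequence $(n_i)_{i=1}^{\infty}$ of positive integers is called $\lambda$-lacunary if $n_{i+1}/n_i\geqslant\lambda$ for every $i\in\mathbb{N}$. For a sequence of positive reals $(x_i)_{i=1}^{\infty}$ one denotes by \[ P((x_i)_{i=1}^{\infty}) := \Big\{ \sum_{i\in T} x_i \,:\, T\subset\mathbb{N} \text{ finite} \Big\} \] the set of all finite sums of terms with distinct indices (the empty set $T$ is allowed and gives the sum $0$). *)

theory Defs
  imports Complex_Main
begin

(* Sequences are indexed by nat from 0, so the term with index i here is the
   term with index i + 1 of a sequence indexed by the positive integers. *)

definition lacunary :: "real \<Rightarrow> (nat \<Rightarrow> nat) \<Rightarrow> bool" where
  "lacunary lam n \<longleftrightarrow>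
     (\<forall>i. 0 < n i) \<and> (\<forall>i. real (n (Suc i)) / real (n i) \<ge> lam)"

definition finite_sums :: "(nat \<Rightarrow> real) \<Rightarrow> real set" where
  "finite_sums x = {\<Sum>i\<in>T. x i | T. finite T}"

end

theory Submission
  imports Defs "HOL-Number_Theory.Residues"
begin

text \<open>
  The ratio 2 is the borderline at which the tail \<open>\<Sum>j>i. 1 / n j\<close> passes from at least to at most
  \<open>1 / n i\<close>. Both halves of the theorem measure the distance to that borderline with the identity
  \<open>sum_tail_telescope\<close>, whose error terms \<open>2 / n (j+1) - 1 / n j\<close> have the same
  sign for all \<open>j\<close> in either half.

  \<^emph>\<open>Existence.\<close> Call an index \<open>J\<close> good if every \<open>n i\<close> with \<open>i \<le> J\<close> divides \<open>n J\<close>. Then the sums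
  of the first \<open>J + 1\<close> reciprocals are, over the common denominator \<open>n J\<close>, the subset sums of the
  integers \<open>n J / n i\<close>. Read backwards, these integers start at 1 and at most double at each step if
  the ratios of \<open>n\<close> are at most 2, so that they are a complete system: every integer up to their total
  is a subset sum (\<open>subset_sums_complete\<close>). A fraction \<open>a / b\<close> is thus a finite sum as soon as
  some good \<open>J\<close> has \<open>b dvd n J\<close> and a total of at least \<open>a / b\<close>. If \<open>n 0 = 1\<close> and ratios below 2 occur,
  the totals eventually reach 2. If such ratios occur infinitely often, the same argument rewrites
  the last term of any sum by means of later terms, which yields infinitely many sums for each value.
  The locale \<open>at_most_doubling\<close> collects the conditions on ratios and divisibility.

  A sequence that satisfies them is obtained by doubling at every step except the steps \<open>i = 2^k\<close>,
  where the factor is \<open>(2^(k+1) - 1) / 2^k = 2 - 1 / i\<close>. The many doublings in between restore the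
  power of 2 that is divided out, so that the slow indices \<open>2^k\<close> are good. By Euler's theorem every odd
  number divides some \<open>2^(k+1) - 1\<close>, so that every denominator is caught. Only large \<open>k\<close> are used,
  which keeps all ratios at or above the given \<open>\<lambda> < 2\<close>.

  \<^emph>\<open>Non-existence.\<close> Let all ratios be at least 2. If they eventually equal 2, the denominators of all
  finite sums divide numbers \<open>L * 2^e\<close> with a fixed \<open>L\<close>, which bounds the power of 3 in them
  (\<open>eventually_doubling_no_interval\<close>). Otherwise every tail falls short of the preceding term by a
  definite amount, and a gap opens just below \<open>p + 1 / n i\<close> for each finite sum \<open>p\<close> of terms before
  the \<open>i\<close>-th (\<open>subset_sum_gap\<close>).
\<close>

section \<open>Tails of sequences of ratio near one half\<close>

text \<open>
  For \<open>x j = 2^(-j)\<close> the error terms vanish. Elsewhere they record by how much each step differs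
  from halving.
\<close>

lemma sum_tail_telescope:
  fixes x :: "nat \<Rightarrow> real"
  assumes "i \<le> m"
  shows "(\<Sum>j\<in>{i<..m}. x j) = x i - x m + (\<Sum>j\<in>{i..<m}. 2 * x (Suc j) - x j)"
  using assms
proof (induction m rule: dec_induct)
  case base
  then show ?case by simp
next
  case (step m)
  have "{i<..Suc m} = insert (Suc m) {i<..m}" using step by auto
  then show ?case using step by (simp add: sum.atLeastLessThan_Suc)
qed

lemma sum_tail_ge:
  fixes x :: "nat \<Rightarrow> real"
  assumes half: "\<And>j. x j \<le> 2 * x (Suc j)" and "i \<le> k" "k < m"
  shows "(\<Sum>j\<in>{i<..m}. x j) \<ge> x i - x m + (2 * x (Suc k) - x k)"
proof -
  have "2 * x (Suc k) - x k \<le> (\<Sum>j\<in>{i..<m}. 2 * x (Suc j) - x j)"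
    using assms by (intro member_le_sum) auto
  then show ?thesis using sum_tail_telescope[of i m x] assms by simp
qed

lemma sum_tail_le:
  fixes x :: "nat \<Rightarrow> real"
  assumes half: "\<And>j. 2 * x (Suc j) \<le> x j" and "i \<le> m"
  shows "(\<Sum>j\<in>{i<..m}. x j) \<le> x i - x m"
proof -
  have "(\<Sum>j\<in>{i..<m}. 2 * x (Suc j) - x j) \<le> 0"
    using half by (intro sum_nonpos) auto
  then show ?thesis using sum_tail_telescope[of i m x] assms by simp
qed

lemma sum_tail_subset_le:
  fixes x :: "nat \<Rightarrow> real"
  assumes pos: "\<And>j. 0 < x j" and half: "\<And>j. 2 * x (Suc j) \<le> x j"
    and U: "finite U" "U \<subseteq> {i<..}" and "i \<le> k"
  shows "sum x U \<le> x i - (x k - 2 * x (Suc k))"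
proof -
  define m where "m = Max (insert (Suc k) U)"
  have fin: "finite (insert (Suc k) U)" using U by simp
  have km: "k < m" using Max_ge[OF fin, of "Suc k"] by (simp add: m_def)
  have "U \<subseteq> {i<..m}" using U Max_ge[OF fin] by (auto simp: m_def)
  then have "sum x U \<le> (\<Sum>j\<in>{i<..m}. x j)"
    using pos by (intro sum_mono2) (auto intro: less_imp_le)
  moreover have "(\<Sum>j\<in>{i<..m}. x j) = x i - x m - (\<Sum>j\<in>{i..<m}. x j - 2 * x (Suc j))"
    using sum_tail_telescope[of i m x] \<open>i \<le> k\<close> km by (simp add: sum_subtractf)
  moreover have "x k - 2 * x (Suc k) \<le> (\<Sum>j\<in>{i..<m}. x j - 2 * x (Suc j))"
    using half km \<open>i \<le> k\<close> by (intro member_le_sum) auto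
  ultimately show ?thesis using pos[of m] by linarith
qed

section \<open>No interval for ratios at least two\<close>

text \<open>
  For a sequence that at least halves at each step, subset sums are ordered lexicographically by
  their index sets. Just above the sum over \<open>T\<close> lie the sums that add indices after \<open>i\<close>, and these add
  at most \<open>x i\<close> minus the shortfall at any single \<open>k \<ge> i\<close>; the sum over \<open>insert i T\<close> comes next. The
  proof compares the index sets at the first place where they differ.
\<close>

lemma subset_sum_gap:
  fixes x :: "nat \<Rightarrow> real"
  assumes pos: "\<And>j. 0 < x j" and half: "\<And>j. 2 * x (Suc j) \<le> x j"
    and T: "T \<subseteq> {..<i}" and U: "finite U" and ik: "i \<le> k"
  shows "sum x U \<le> sum x T + x i - (x k - 2 * x (Suc k)) \<or> sum x T + x i \<le> sum x U"
proof -
  have finT: "finite T" using T finite_subset by blast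
  have mono: "x b \<le> x a" if "a \<le> b" for a b
  proof (rule lift_Suc_antimono_le[OF _ that])
    show "x (Suc n) \<le> x n" for n using half[of n] pos[of "Suc n"] by simp
  qed
  show ?thesis
  proof (cases "U \<inter> {..i} = T")
    case True
    have "U = T \<union> (U \<inter> {i<..})" using True by force
    moreover have "T \<inter> (U \<inter> {i<..}) = {}" using T by auto
    ultimately have "sum x U = sum x T + sum x (U \<inter> {i<..})"
      using finT U by (metis finite_Int sum.union_disjoint)
    then show ?thesis
      using sum_tail_subset_le[of x "U \<inter> {i<..}" i k, OF pos half _ _ ik] U by simp
  next
    case False
    define P where "P j \<longleftrightarrow> j \<le> i \<and> (j \<in> U) \<noteq> (j \<in> T)" for j
    define j where "j = (LEAST j. P j)"
    have "\<exists>j. P j" using False T unfolding P_def by fastforce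
    then have Pj: "P j" unfolding j_def by (rule LeastI_ex)
    have least: "\<not> P l" if "l < j" for l using not_less_Least that unfolding j_def by blast
    define C where "C = T \<inter> {..<j}"
    have CU: "C = U \<inter> {..<j}" using least Pj unfolding C_def P_def by force
    have finC: "finite C" using finT by (simp add: C_def)
    show ?thesis
    proof (cases "j \<in> U")
      case True
      then have jT: "j \<notin> T" using Pj by (simp add: P_def)
      have "sum x (insert j C) \<le> sum x U"
        using U CU True pos by (intro sum_mono2) (auto intro: less_imp_le)
      then have ge: "sum x C + x j \<le> sum x U" using finC by (simp add: C_def)
      have "sum x T + x i \<le> sum x C + x j"
      proof (cases "j = i")
        case True
        then have "C = T" using T by (auto simp: C_def)
        then show ?thesis using True by simp
      next
        case False
        then have ji: "j < i" using Pj by (simp add: P_def)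
        have "i \<notin> T" using T by auto
        then have "sum x T + x i = sum x (insert i T)" using finT by simp
        moreover have "insert i T \<subseteq> C \<union> {j<..i}"
        proof
          fix l assume "l \<in> insert i T"
          then show "l \<in> C \<union> {j<..i}"
            using ji jT T by (cases l j rule: linorder_cases) (auto simp: C_def)
        qed
        then have "sum x (insert i T) \<le> sum x (C \<union> {j<..i})"
          using finC pos by (intro sum_mono2) (auto intro: less_imp_le)
        moreover have "sum x (C \<union> {j<..i}) = sum x C + sum x {j<..i}"
          using finC by (intro sum.union_disjoint) (auto simp: C_def)
        moreover have "sum x {j<..i} \<le> x j"
          using sum_tail_le[of x j i, OF half] ji pos[of i] by simp
        ultimately show ?thesis by simp
      qed
      then show ?thesis using ge by simp
    next
      case False
      then have jT: "j \<in> T" using Pj by (simp add: P_def)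
      have "U = C \<union> (U \<inter> {j<..})" using False CU by force
      moreover have "C \<inter> (U \<inter> {j<..}) = {}" by (auto simp: C_def)
      ultimately have "sum x U = sum x C + sum x (U \<inter> {j<..})"
        using finC U by (metis finite_Int sum.union_disjoint)
      also have "\<dots> \<le> sum x C + x j"
        using sum_tail_subset_le[of x "U \<inter> {j<..}" j j, OF pos half] U half[of j] by simp
      also have "\<dots> = sum x (insert j C)" using finC by (simp add: C_def)
      also have "\<dots> \<le> sum x T"
        using finT jT pos by (intro sum_mono2) (auto simp: C_def intro: less_imp_le)
      finally have "sum x U \<le> sum x T" .
      moreover have "x k - 2 * x (Suc k) \<le> x i" using mono[OF ik] pos[of "Suc k"] by simp
      ultimately show ?thesis by simp
    qed
  qed
qed

lemma finite_sums_iff: "y \<in> finite_sums x \<longleftrightarrow> (\<exists>T. finite T \<and> y = sum x T)"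
  unfolding finite_sums_def by auto

lemma lacunary_2_doubling:
  assumes "lacunary 2 n"
  shows "2 * n i \<le> n (Suc i)"
proof -
  have "0 < n i" "2 \<le> real (n (Suc i)) / real (n i)" using assms by (simp_all add: lacunary_def)
  then have "real (2 * n i) \<le> real (n (Suc i))" by (simp add: pos_le_divide_eq)
  then show ?thesis by (simp only: of_nat_le_iff)
qed

text \<open>
  The gap lies above a rational \<open>p\<close> of the interval that is itself a finite sum, and its upper end
  \<open>p + x i\<close> stays inside the interval when \<open>i\<close> is large.
\<close>

lemma lacunary_2_strict_no_interval:
  fixes n :: "nat \<Rightarrow> nat"
  assumes lac: "lacunary 2 n" and strict: "\<exists>\<^sub>\<infinity>k. 2 * n k < n (Suc k)" and "a < b"
  shows "\<not> {a<..<b} \<inter> \<rat> \<subseteq> finite_sums (\<lambda>i. 1 / real (n i))"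
proof
  assume sub: "{a<..<b} \<inter> \<rat> \<subseteq> finite_sums (\<lambda>i. 1 / real (n i))"
  define x where "x = (\<lambda>i. 1 / real (n i))"
  have repr: "\<exists>T. finite T \<and> y = sum x T" if "a < y" "y < b" "y \<in> \<rat>" for y
    using that sub finite_sums_iff unfolding x_def by (metis IntI greaterThanLessThan_iff subsetD)
  have npos: "0 < n i" for i using lac by (simp add: lacunary_def)
  have dbl: "2 * real (n i) \<le> real (n (Suc i))" for i
    using lacunary_2_doubling[OF lac, of i] by (simp flip: of_nat_le_iff[where 'a=real])
  have pos: "0 < x i" for i using npos by (simp add: x_def)
  have half: "2 * x (Suc i) \<le> x i" for i
    using dbl[of i] npos[of i] npos[of "Suc i"] by (simp add: x_def field_simps)
  have xle: "x i \<le> x 0 * (1/2) ^ i" for i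
  proof (induction i)
    case (Suc i)
    then show ?case using half[of i] by simp
  qed simp
  have x0: "x \<longlonglongrightarrow> 0"
  proof (rule real_tendsto_sandwich[where f = "\<lambda>_. 0"])
    show "(\<lambda>i. x 0 * (1/2) ^ i) \<longlonglongrightarrow> 0"
      by (intro tendsto_mult_right_zero LIMSEQ_power_zero) simp
  qed (use xle less_imp_le[OF pos] in simp_all)
  obtain p where p: "p \<in> \<rat>" "a < p" "p < b" using Rats_dense_in_real[OF \<open>a < b\<close>] by blast
  then obtain T where T: "finite T" "p = sum x T" using repr by blast
  have "\<forall>\<^sub>F i in sequentially. x i < b - p" using order_tendstoD(2)[OF x0] p by simp
  moreover have "\<forall>\<^sub>F i in sequentially. Max (insert 0 T) < i" by (rule eventually_gt_at_top)
  ultimately obtain i where i: "x i < b - p" "Max (insert 0 T) < i"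
    using eventually_conj eventually_happens' sequentially_bot by blast
  have Ti: "T \<subseteq> {..<i}"
    using i(2) T(1)
    by (metis Max_less_iff finite_insert insert_not_empty insertCI lessThan_iff subsetI)
  obtain k where k: "i \<le> k" "2 * n k < n (Suc k)"
    using strict unfolding INFM_nat_le by blast
  define \<delta> where "\<delta> = x k - 2 * x (Suc k)"
  have "real (2 * n k) < real (n (Suc k))" using k(2) by (simp only: of_nat_less_iff)
  then have \<delta>: "\<delta> > 0"
    using npos[of k] npos[of "Suc k"] by (simp add: \<delta>_def x_def field_simps)
  \<comment> \<open>The minimum with \<open>x i\<close> only serves to keep the rational \<open>y\<close> above \<open>p\<close>.\<close>
  have "p + x i - min \<delta> (x i) < p + x i" using \<delta> pos[of i] by simp
  then obtain y where y: "y \<in> \<rat>" "p + x i - min \<delta> (x i) < y" "y < p + x i"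
    using Rats_dense_in_real by blast
  have "a < y" "y < b" using y p i(1) by auto
  then obtain U where U: "finite U" "y = sum x U" using repr y(1) by blast
  show False
    using subset_sum_gap[of x T i U k, OF pos half Ti U(1) k(1)] y U T by (auto simp: \<delta>_def)
qed

text \<open>
  Every finite sum has a denominator \<open>L * 2^e\<close>. If \<open>p\<close> is such a sum, then \<open>p + 1 / (3 * L * 2^f)\<close>
  is not, since the extra factor 3 cannot be cancelled by powers of 2.
\<close>

lemma eventually_doubling_no_interval:
  fixes n :: "nat \<Rightarrow> nat"
  assumes npos: "\<And>i. 0 < n i" and dbl: "\<And>k. m \<le> k \<Longrightarrow> n (Suc k) = 2 * n k" and "a < b"
  shows "\<not> {a<..<b} \<inter> \<rat> \<subseteq> finite_sums (\<lambda>i. 1 / real (n i))"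
proof
  assume sub: "{a<..<b} \<inter> \<rat> \<subseteq> finite_sums (\<lambda>i. 1 / real (n i))"
  define L where "L = (\<Prod>l\<le>m. n l)"
  have Lpos: "0 < L" using npos by (simp add: L_def prod_pos)
  have pow: "n (m + j) = 2 ^ j * n m" for j
    by (induction j) (simp_all add: dbl)
  have dvd: "n i dvd L * 2 ^ e" if "i \<le> e" for i e
  proof (cases "i \<le> m")
    case True
    then have "n i dvd L" unfolding L_def by (intro dvd_prodI) auto
    then show ?thesis by simp
  next
    case False
    then have "n i = 2 ^ (i - m) * n m" using pow[of "i - m"] by simp
    moreover have "n m dvd L" unfolding L_def by (intro dvd_prodI) auto
    moreover have "(2::nat) ^ (i - m) dvd 2 ^ e" using that by (intro le_imp_power_dvd) simp
    ultimately show ?thesis by (metis mult.commute mult_dvd_mono)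
  qed
  have int: "\<exists>e0. \<forall>e\<ge>e0. y * real (L * 2 ^ e) \<in> \<int>"
    if y: "y \<in> finite_sums (\<lambda>i. 1 / real (n i))" for y
  proof -
    obtain T where T: "finite T" "y = (\<Sum>i\<in>T. 1 / real (n i))"
      using y unfolding finite_sums_iff by blast
    have "y * real (L * 2 ^ e) \<in> \<int>" if e: "Max (insert 0 T) \<le> e" for e
    proof -
      have "y * real (L * 2 ^ e) = (\<Sum>i\<in>T. real (L * 2 ^ e) / real (n i))"
        by (simp add: T sum_distrib_right)
      also have "\<dots> = (\<Sum>i\<in>T. real (L * 2 ^ e div n i))"
        using T e by (intro sum.cong refl real_of_nat_div[symmetric] dvd) auto
      also have "\<dots> \<in> \<int>" by (intro Ints_sum Ints_of_nat)
      finally show ?thesis .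
    qed
    then show ?thesis by blast
  qed
  obtain p where p: "p \<in> \<rat>" "a < p" "p < b" using Rats_dense_in_real[OF \<open>a < b\<close>] by blast
  obtain f where f: "(1/2) ^ f < b - p" using real_arch_pow_inv[of "b - p" "1/2"] p by auto
  define y where "y = p + 1 / real (3 * L * 2 ^ f)"
  have "1 * 2 ^ f \<le> 3 * L * 2 ^ f" using Lpos by (intro mult_right_mono) auto
  then have "real (2 ^ f) \<le> real (3 * L * 2 ^ f)" by (simp only: of_nat_le_iff mult_1)
  then have "1 / real (3 * L * 2 ^ f) \<le> 1 / real (2 ^ f)"
    by (intro divide_left_mono) (use Lpos in auto)
  then have "y < b" using f by (simp add: y_def power_one_over)
  moreover have "p < y" using Lpos by (simp add: y_def)
  then have "a < y" using p(2) by simp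
  moreover have "y \<in> \<rat>" using p(1) by (simp add: y_def)
  ultimately have "y \<in> {a<..<b} \<inter> \<rat>" by simp
  then obtain e1 where e1: "\<And>e. e1 \<le> e \<Longrightarrow> y * real (L * 2 ^ e) \<in> \<int>" using sub int by (meson subsetD)
  obtain e2 where e2: "\<And>e. e2 \<le> e \<Longrightarrow> p * real (L * 2 ^ e) \<in> \<int>"
    using sub int p by (meson IntI greaterThanLessThan_iff subsetD)
  define e where "e = f + e1 + e2"
  have "y * real (L * 2 ^ e) - p * real (L * 2 ^ e) \<in> \<int>"
    using e1[of e] e2[of e] by (simp add: e_def)
  also have "y * real (L * 2 ^ e) - p * real (L * 2 ^ e) = 2 ^ (e1 + e2) / 3"
    using Lpos by (simp add: y_def e_def field_simps power_add)
  finally obtain z where "2 ^ (e1 + e2) / 3 = real_of_int z" by (elim Ints_cases)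
  then have "real_of_int (2 ^ (e1 + e2)) = real_of_int (3 * z)" by simp
  then have "(3::int) dvd 2 ^ (e1 + e2)" by (metis dvd_triv_left of_int_eq_iff)
  then have "(3::int) dvd 2" using prime_dvd_power[of "3::int" 2] by simp
  then show False by presburger
qed

lemma lacunary_2_no_interval:
  assumes lac: "lacunary 2 n" and "a < b"
  shows "\<not> {a<..<b} \<inter> \<rat> \<subseteq> finite_sums (\<lambda>i. 1 / real (n i))"
proof (cases "\<exists>\<^sub>\<infinity>k. 2 * n k < n (Suc k)")
  case True
  then show ?thesis using lacunary_2_strict_no_interval assms by blast
next
  case False
  then obtain m where m: "\<And>k. m \<le> k \<Longrightarrow> n (Suc k) \<le> 2 * n k"
    unfolding INFM_nat_le by (meson not_less)
  have npos: "0 < n i" for i using lac by (simp add: lacunary_def)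
  have "n (Suc k) = 2 * n k" if "m \<le> k" for k
    using m[OF that] lacunary_2_doubling[OF lac, of k] by simp
  then show ?thesis using eventually_doubling_no_interval[of n m a b] npos \<open>a < b\<close> by blast
qed

section \<open>Representing every rational\<close>

text \<open>
  Induction from \<open>J\<close> downwards, along with the bound \<open>d t \<le> sum d {t<..J} + 1\<close>: if \<open>m\<close> exceeds the sum
  of the entries after \<open>t\<close>, then it is at least \<open>d t\<close>, and \<open>m - d t\<close> is within reach of those entries.
\<close>

lemma subset_sums_complete:
  fixes d :: "nat \<Rightarrow> nat"
  assumes "t \<le> J" and last: "d J = 1" and step: "\<And>j. j < J \<Longrightarrow> d j \<le> 2 * d (Suc j)"
    and "m \<le> sum d {t..J}"
  shows "\<exists>T\<subseteq>{t..J}. sum d T = m"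
proof -
  have "d t \<le> sum d {t<..J} + 1 \<and> (\<forall>m\<le>sum d {t..J}. \<exists>T\<subseteq>{t..J}. sum d T = m)"
    using \<open>t \<le> J\<close>
  proof (induction t rule: inc_induct)
    case base
    have "\<exists>T\<subseteq>{J}. sum d T = m" if "m \<le> 1" for m
      using that last by (cases "m = 0") (auto intro: exI[of _ "{}"] exI[of _ "{J}"])
    then show ?case using last by simp
  next
    case (step t)
    have tail: "{t<..J} = {Suc t..J}" by auto
    have head: "{t..J} = insert t {Suc t..J}" "{Suc t..J} = insert (Suc t) {Suc t<..J}"
      using step(2) by auto
    have S: "sum d {t..J} = d t + sum d {Suc t..J}" by (subst head(1)) simp
    have S': "sum d {Suc t..J} = d (Suc t) + sum d {Suc t<..J}" by (subst head(2)) simp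
    have dt: "d t \<le> sum d {Suc t..J} + 1"
      using assms(3)[OF step(2)] step.IH S' by simp
    have "\<exists>T\<subseteq>{t..J}. sum d T = m" if m: "m \<le> sum d {t..J}" for m
    proof (cases "m \<le> sum d {Suc t..J}")
      case True
      then obtain T where "T \<subseteq> {Suc t..J}" "sum d T = m" using step.IH by blast
      then show ?thesis using head(1) by blast
    next
      case False
      then have "m - d t \<le> sum d {Suc t..J}" "d t \<le> m" using S m dt by auto
      then obtain T where T: "T \<subseteq> {Suc t..J}" "sum d T = m - d t" using step.IH by blast
      then have "finite T" "t \<notin> T" using finite_subset by auto
      then have "sum d (insert t T) = m" using T \<open>d t \<le> m\<close> by simp
      then show ?thesis using T(1) head(1) by blast
    qed
    then show ?case using dt tail by simp
  qed
  then show ?thesis using assms(4) by blast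
qed

locale at_most_doubling =
  fixes n :: "nat \<Rightarrow> nat"
  assumes pos: "0 < n i"
    and le_double: "n (Suc i) \<le> 2 * n i"
    and strict: "\<exists>\<^sub>\<infinity>k. n (Suc k) < 2 * n k"
    and common_multiple: "0 < b \<Longrightarrow> \<exists>J\<ge>N. b dvd n J \<and> (\<forall>i\<le>J. n i dvd n J)"
begin

lemma half_le: "1 / real (n i) \<le> 2 * (1 / real (n (Suc i)))"
proof -
  have "real (n (Suc i)) \<le> 2 * real (n i)"
    using le_double[of i] by (simp flip: of_nat_le_iff[where 'a=real])
  then show ?thesis using pos[of i] pos[of "Suc i"] by (simp add: field_simps)
qed

text \<open>
  Multiplied by \<open>n J\<close>, the reciprocals become the integers \<open>n J div n i\<close>, to which
  \<open>subset_sums_complete\<close> applies.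
\<close>

lemma multiple_of_last_is_sum:
  assumes "t \<le> J" and dvd: "\<And>i. i \<le> J \<Longrightarrow> n i dvd n J"
    and bound: "real m / real (n J) \<le> (\<Sum>i\<in>{t..J}. 1 / real (n i))"
  shows "\<exists>T\<subseteq>{t..J}. (\<Sum>i\<in>T. 1 / real (n i)) = real m / real (n J)"
proof -
  define d where "d i = n J div n i" for i
  have d: "real (d i) = real (n J) * (1 / real (n i))" if "i \<le> J" for i
    using real_of_nat_div[OF dvd[OF that]] by (simp add: d_def)
  have dsum: "real (sum d T) = real (n J) * (\<Sum>i\<in>T. 1 / real (n i))" if "T \<subseteq> {t..J}" for T
    using that d by (subst of_nat_sum, subst sum_distrib_left) (intro sum.cong; auto)
  have "d J = 1" using pos[of J] by (simp add: d_def)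
  moreover have "d j \<le> 2 * d (Suc j)" if "j < J" for j
  proof -
    have "real (d j) = real (n J) * (1 / real (n j))" using d that by simp
    also have "\<dots> \<le> real (n J) * (2 * (1 / real (n (Suc j))))"
      by (intro mult_left_mono half_le) simp
    also have "\<dots> = real (2 * d (Suc j))" using d[of "Suc j"] that by simp
    finally show ?thesis by (simp only: of_nat_le_iff)
  qed
  moreover have "m \<le> sum d {t..J}"
  proof -
    have "real m \<le> real (sum d {t..J})"
      using bound pos[of J] dsum[of "{t..J}"] by (simp add: pos_divide_le_eq mult.commute)
    then show ?thesis by (simp only: of_nat_le_iff)
  qed
  ultimately obtain T where T: "T \<subseteq> {t..J}" "sum d T = m"
    using subset_sums_complete[OF \<open>t \<le> J\<close>] by blast
  then have "(\<Sum>i\<in>T. 1 / real (n i)) = real m / real (n J)"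
    using dsum[OF T(1)] pos[of J] by (simp add: field_simps)
  then show ?thesis using T(1) by blast
qed

text \<open>
  A ratio below 2 at some \<open>k \<ge> t\<close> gives the tail after \<open>t\<close> a surplus \<open>\<delta>\<close> over \<open>1 / n t\<close>, up to the
  missing \<open>1 / n J\<close>. That loss is made at most \<open>\<delta>\<close> by asking \<open>n J\<close> to be a multiple of some
  \<open>c > 1 / \<delta>\<close> in addition to \<open>b\<close>.
\<close>

lemma later_terms_dominate:
  assumes "0 < b"
  shows "\<exists>J>t. b dvd n J \<and> (\<forall>i\<le>J. n i dvd n J) \<and>
           1 / real (n t) \<le> (\<Sum>i\<in>{t<..J}. 1 / real (n i))"
proof -
  obtain k where k: "t \<le> k" "n (Suc k) < 2 * n k" using strict unfolding INFM_nat_le by blast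
  define \<delta> where "\<delta> = 2 * (1 / real (n (Suc k))) - 1 / real (n k)"
  have "real (n (Suc k)) < real (2 * n k)" using k(2) by (simp only: of_nat_less_iff)
  then have \<delta>: "\<delta> > 0" using pos[of k] pos[of "Suc k"] by (simp add: \<delta>_def field_simps)
  obtain c where c: "c > 0" "1 / real c < \<delta>" using reals_Archimedean[OF \<delta>]
    by (metis inverse_eq_divide zero_less_Suc)
  obtain J where J: "J \<ge> Suc k" "b * c dvd n J" "\<forall>i\<le>J. n i dvd n J"
    using common_multiple[of "b * c" "Suc k"] \<open>0 < b\<close> c(1) by auto
  have "c \<le> n J" using J(2) pos[of J] by (meson dvd_imp_le dvd_mult_right)
  then have "1 / real (n J) \<le> 1 / real c" using c(1) by (intro divide_left_mono) auto
  then have "1 / real (n J) \<le> \<delta>" using c(2) by simp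
  then have "1 / real (n t) \<le> (\<Sum>i\<in>{t<..J}. 1 / real (n i))"
    using sum_tail_ge[of "\<lambda>i. 1 / real (n i)" t k J, OF half_le k(1)] J(1) by (simp add: \<delta>_def)
  moreover have "b dvd n J" using J(2) by (rule dvd_mult_left)
  ultimately show ?thesis using J k by (intro exI[of _ J]) auto
qed

lemma rational_is_sum:
  assumes q: "q \<in> \<rat>" "0 \<le> q" "q \<le> 2 / real (n 0)"
  shows "\<exists>T. finite T \<and> q = (\<Sum>i\<in>T. 1 / real (n i))"
proof -
  obtain a b where ab: "b \<noteq> 0" "\<bar>q\<bar> = real a / real b" using Rats_abs_nat_div_natE[OF q(1)] by metis
  then have qab: "q = real a / real b" "0 < b" using q(2) by auto
  obtain J where J: "b dvd n J" "\<And>i. i \<le> J \<Longrightarrow> n i dvd n J"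
      "1 / real (n 0) \<le> (\<Sum>i\<in>{0<..J}. 1 / real (n i))"
    using later_terms_dominate[OF qab(2), of 0] by blast
  obtain c where c: "n J = b * c" using J(1) by blast
  have cpos: "c > 0" using c pos[of J] by (cases c) auto
  have q': "q = real (a * c) / real (n J)" using qab c cpos by simp
  have "{0..J} = insert 0 {0<..J}" by auto
  then have "(\<Sum>i\<in>{0..J}. 1 / real (n i)) = 1 / real (n 0) + (\<Sum>i\<in>{0<..J}. 1 / real (n i))"
    by simp
  then have "real (a * c) / real (n J) \<le> (\<Sum>i\<in>{0..J}. 1 / real (n i))"
    using J(3) q(3) q' by simp
  then obtain T where "T \<subseteq> {0..J}" "(\<Sum>i\<in>T. 1 / real (n i)) = q"
    using multiple_of_last_is_sum[of 0 J "a * c", OF _ J(2)] q' by auto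
  then show ?thesis using finite_subset by blast
qed

text \<open>
  The largest index \<open>t\<close> is traded for indices after \<open>t\<close>: the reciprocal \<open>1 / n t\<close> is a multiple of
  \<open>1 / n J\<close> and is dominated by the terms between \<open>t\<close> and \<open>J\<close>, so that it is a sum of some of them.
\<close>

lemma sum_with_later_index:
  assumes T: "finite T" "T \<noteq> {}"
  shows "\<exists>T'. finite T' \<and> (\<Sum>i\<in>T'. 1 / real (n i)) = (\<Sum>i\<in>T. 1 / real (n i)) \<and>
           T' \<noteq> {} \<and> Max T < Max T'"
proof -
  define t where "t = Max T"
  have t: "t \<in> T" using T by (simp add: t_def)
  have le: "i \<le> t" if "i \<in> T" for i using T that by (simp add: t_def)
  obtain J where J: "t < J" "\<And>i. i \<le> J \<Longrightarrow> n i dvd n J"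
      "1 / real (n t) \<le> (\<Sum>i\<in>{t<..J}. 1 / real (n i))"
    using later_terms_dominate[of 1 t] by auto
  obtain c where c: "n J = n t * c" using J(1) J(2)[of t] by (auto simp: dvd_def)
  have cpos: "c > 0" using c pos[of J] by (cases c) auto
  have nt: "1 / real (n t) = real c / real (n J)" using c cpos pos[of t] by simp
  have "{t<..J} = {Suc t..J}" by auto
  then obtain V where V: "V \<subseteq> {Suc t..J}" "(\<Sum>i\<in>V. 1 / real (n i)) = 1 / real (n t)"
    using multiple_of_last_is_sum[of "Suc t" J c, OF _ J(2)] J(1,3) nt by auto
  have finV: "finite V" using V(1) finite_subset by blast
  have "V \<noteq> {}" using V(2) pos[of t] by auto
  define T' where "T' = (T - {t}) \<union> V"
  have "(T - {t}) \<inter> V = {}" using le V(1) by fastforce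
  then have "(\<Sum>i\<in>T'. 1 / real (n i)) = (\<Sum>i\<in>T - {t}. 1 / real (n i)) + (\<Sum>i\<in>V. 1 / real (n i))"
    unfolding T'_def using T(1) finV by (simp add: sum.union_disjoint)
  also have "\<dots> = (\<Sum>i\<in>T. 1 / real (n i))"
    using V(2) sum.remove[OF T(1) t, of "\<lambda>i. 1 / real (n i)"] by simp
  finally have sum: "(\<Sum>i\<in>T'. 1 / real (n i)) = (\<Sum>i\<in>T. 1 / real (n i))" .
  have fin: "finite T'" using T finV by (simp add: T'_def)
  obtain v where v: "v \<in> V" using \<open>V \<noteq> {}\<close> by blast
  then have "t < v" using V(1) by auto
  also have "v \<le> Max T'" using v fin by (simp add: T'_def)
  finally have "Max T < Max T'" by (simp add: t_def)
  then show ?thesis using fin sum v by (intro exI[of _ T']) (auto simp: T'_def)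
qed

lemma infinitely_many_sums:
  assumes q: "q \<in> \<rat>" "0 < q" "q \<le> 2 / real (n 0)"
  shows "infinite {T. finite T \<and> q = (\<Sum>i\<in>T. 1 / real (n i))}" (is "infinite ?R")
proof
  assume fin: "finite ?R"
  have "?R \<noteq> {}" using rational_is_sum[of q] q by auto
  then have "Max (Max ` ?R) \<in> Max ` ?R" using fin by (intro Max_in) auto
  then obtain T where T: "T \<in> ?R" "Max T = Max (Max ` ?R)" by auto
  have "T \<noteq> {}" using T(1) q(2) by auto
  moreover have "finite T" using T(1) by simp
  ultimately obtain T' where T': "finite T'" "Max T < Max T'"
      "(\<Sum>i\<in>T'. 1 / real (n i)) = (\<Sum>i\<in>T. 1 / real (n i))"
    using sum_with_later_index by metis
  then have "T' \<in> ?R" using T(1) by simp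
  then have "Max T' \<le> Max (Max ` ?R)" using fin by (intro Max_ge) auto
  then show False using T(2) T'(2) by simp
qed

end

section \<open>A doubling sequence with sparse slower steps\<close>

definition slow_step :: "nat \<Rightarrow> nat \<Rightarrow> bool" where
  "slow_step K i \<longleftrightarrow> (\<exists>k\<ge>K. i = 2 ^ k)"

text \<open>
  At a slow step \<open>i = 2^k\<close> the ratio is \<open>2 - 1 / i\<close>; the division by \<open>i\<close> is exact when \<open>K \<ge> 2\<close> by
  \<open>power_dvd_slow_seq\<close>. Powers of 2 as positions leave \<open>2^k - 1\<close> doublings before the next slow step,
  enough to supply the factor \<open>2^(k+1)\<close> that is divided out there.
\<close>

fun slow_seq :: "nat \<Rightarrow> nat \<Rightarrow> nat" where
  "slow_seq K 0 = 1"
| "slow_seq K (Suc i) =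
     (if slow_step K i then slow_seq K i div i * (2 * i - 1) else 2 * slow_seq K i)"

(* As a rewrite rule the recursion would split every term slow_seq K (Suc i) into two cases. *)
declare slow_seq.simps(2) [simp del]

lemma slow_seq_Suc_special:
  "K \<le> k \<Longrightarrow> slow_seq K (Suc (2 ^ k)) = slow_seq K (2 ^ k) div 2 ^ k * (2 ^ Suc k - 1)"
  by (auto simp: slow_seq.simps(2) slow_step_def)

lemma slow_seq_Suc_double: "\<not> slow_step K i \<Longrightarrow> slow_seq K (Suc i) = 2 * slow_seq K i"
  unfolding slow_seq.simps(2) by (rule if_not_P)

lemma slow_seq_initial: "i \<le> 2 ^ K \<Longrightarrow> slow_seq K i = 2 ^ i"
proof (induction i)
  case (Suc i)
  have "\<not> slow_step K i"
  proof
    assume "slow_step K i"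
    then have "2 ^ K \<le> i" by (auto simp: slow_step_def intro: power_increasing)
    then show False using Suc by simp
  qed
  then show ?case using Suc by (simp add: slow_seq_Suc_double)
qed simp

text \<open>
  Between consecutive slow steps the sequence is a geometric progression of ratio 2; the block after
  \<open>2^k\<close> consists of the indices \<open>2^k + 1 + j\<close> with \<open>j < 2^k\<close>.
\<close>

lemma slow_seq_block:
  assumes "K \<le> k" "j < 2 ^ k"
  shows "slow_seq K (2 ^ k + 1 + j) = 2 ^ j * (slow_seq K (2 ^ k) div 2 ^ k * (2 ^ Suc k - 1))"
  using assms(2)
proof (induction j)
  case 0
  show ?case using slow_seq_Suc_special[OF assms(1)] by simp
next
  case (Suc j)
  have "\<not> slow_step K (2 ^ k + 1 + j)"
  proof
    assume "slow_step K (2 ^ k + 1 + j)"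
    then obtain l where l: "2 ^ k + 1 + j = (2::nat) ^ l" unfolding slow_step_def by blast
    then have "(2::nat) ^ k < 2 ^ l" by linarith
    then have "k < l" by simp
    have "(2::nat) ^ l < 2 ^ Suc k" using l Suc.prems by simp
    then have "l < Suc k" by (simp only: power_strict_increasing_iff[of "2::nat"])
    then show False using \<open>k < l\<close> by simp
  qed
  from slow_seq_Suc_double[OF this] show ?case using Suc by simp
qed

lemma slow_seq_block_end:
  assumes "K \<le> k"
  shows "slow_seq K (2 ^ Suc k) =
           2 ^ (2 ^ k - 1) * (slow_seq K (2 ^ k) div 2 ^ k * (2 ^ Suc k - 1))"
proof -
  have eq: "2 ^ k + 1 + (2 ^ k - 1) = (2::nat) ^ Suc k" using one_le_power[of "2::nat" k] by simp
  have "2 ^ k - 1 < (2::nat) ^ k" by simp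
  from slow_seq_block[OF assms this] show ?thesis by (simp only: eq)
qed

lemma less_power_minus_one: "2 \<le> k \<Longrightarrow> k < 2 ^ k - (1::nat)"
proof (induction k rule: dec_induct)
  case (step k)
  then show ?case by simp
qed simp

lemma power_dvd_slow_seq:
  assumes "2 \<le> K" "K \<le> k"
  shows "2 ^ k dvd slow_seq K (2 ^ k)"
proof (cases "k = K")
  case True
  then show ?thesis using slow_seq_initial[of "2 ^ K" K] by (auto intro!: le_imp_power_dvd less_imp_le)
next
  case False
  then obtain l where l: "k = Suc l" "K \<le> l" using assms by (cases k) auto
  then have "Suc l \<le> 2 ^ l - 1" using less_power_minus_one[of l] assms by simp
  then have "(2::nat) ^ k dvd 2 ^ (2 ^ l - 1)" unfolding l(1) by (rule le_imp_power_dvd)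
  then show ?thesis using slow_seq_block_end[OF l(2)] l(1) by simp
qed

text \<open>
  The slow step loses a factor \<open>2^k\<close>, but the \<open>2^k - 1 \<ge> k\<close> doublings up to the end of the block
  restore it, so the value at \<open>2^(k+1)\<close> is a multiple of the one at \<open>2^k\<close>. Inside a block
  divisibility is clear from the doubling.
\<close>

lemma slow_seq_dvd_block_end:
  assumes "2 \<le> K" "K \<le> k" "i \<le> 2 ^ k"
  shows "slow_seq K i dvd slow_seq K (2 ^ k)"
  using assms(2,3)
proof (induction k arbitrary: i rule: dec_induct)
  case base
  then show ?case using slow_seq_initial[of i K] slow_seq_initial[of "2 ^ K" K] by (simp add: le_imp_power_dvd)
next
  case (step k)
  show ?case
  proof (cases "i \<le> 2 ^ k")
    case True
    define w where "w = slow_seq K (2 ^ k) div 2 ^ k"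
    have w: "slow_seq K (2 ^ k) = 2 ^ k * w"
      using power_dvd_slow_seq[of K k] assms(1) step by (simp add: w_def)
    have "k \<le> 2 ^ k - 1" using less_power_minus_one[of k] assms(1) step by simp
    then have "(2::nat) ^ k dvd 2 ^ (2 ^ k - 1)" by (rule le_imp_power_dvd)
    then have "2 ^ k * w dvd 2 ^ (2 ^ k - 1) * (w * (2 ^ Suc k - 1))"
      by (intro mult_dvd_mono) auto
    then have "slow_seq K (2 ^ k) dvd slow_seq K (2 ^ Suc k)"
      using slow_seq_block_end[OF step(1)] unfolding w_def[symmetric] w[symmetric] by simp
    then show ?thesis using step.IH[OF True] dvd_trans by blast
  next
    case False
    define j where "j = i - 2 ^ k - 1"
    have i: "i = 2 ^ k + 1 + j" and j: "j < 2 ^ k" using False step by (auto simp: j_def)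
    have "(2::nat) ^ j dvd 2 ^ (2 ^ k - 1)" using j by (intro le_imp_power_dvd) simp
    then show ?thesis
      unfolding i slow_seq_block[OF step(1) j] slow_seq_block_end[OF step(1)] by (rule mult_dvd_mono) simp
  qed
qed

lemma slow_seq_pos: "2 \<le> K \<Longrightarrow> 0 < slow_seq K i"
proof (induction i)
  case (Suc i)
  show ?case
  proof (cases "slow_step K i")
    case True
    then obtain k where k: "K \<le> k" "i = 2 ^ k" unfolding slow_step_def by blast
    then have "i \<le> slow_seq K i" using power_dvd_slow_seq[of K k] Suc dvd_imp_le by blast
    then have "0 < slow_seq K i div i" using k by (simp add: div_greater_zero_iff)
    moreover have "(1::nat) < 2 ^ Suc k" by (rule one_less_power) simp_all
    then have "(0::nat) < 2 ^ Suc k - 1" by (simp only: zero_less_diff)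
    ultimately show ?thesis unfolding k(2) slow_seq_Suc_special[OF k(1)] by (rule mult_pos_pos)
  next
    case False
    then show ?thesis using Suc by (simp add: slow_seq_Suc_double)
  qed
qed simp

lemma slow_seq_ratio:
  assumes "2 \<le> K"
  shows "real (slow_seq K (Suc i)) / real (slow_seq K i) =
           (if slow_step K i then 2 - 1 / real i else 2)"
proof (cases "slow_step K i")
  case True
  then obtain k where k: "K \<le> k" "i = 2 ^ k" unfolding slow_step_def by blast
  then have "i dvd slow_seq K i" using power_dvd_slow_seq[of K k] assms by blast
  then obtain w where w: "slow_seq K i = i * w" by blast
  have i: "0 < i" using k by simp
  have wpos: "0 < w" using w slow_seq_pos[OF assms, of i] by (cases w) auto
  have "slow_seq K (Suc i) = w * (2 * i - 1)" using slow_seq_Suc_special[OF k(1)] w i k(2) by simp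
  moreover have "real (2 * i - 1) = 2 * real i - 1" using i by (simp add: of_nat_diff)
  ultimately show ?thesis using True w i wpos by (simp add: field_simps)
next
  case False
  then show ?thesis using slow_seq_pos[OF assms, of i] by (simp add: slow_seq_Suc_double)
qed

text \<open>
  The exponent is a multiple of \<open>totient c\<close>, taken large enough to exceed \<open>N\<close>.
\<close>

lemma dvd_mersenne:
  fixes c :: nat
  assumes "odd c"
  shows "\<exists>k\<ge>N. c dvd 2 ^ Suc k - 1"
proof -
  have "coprime 2 c" using assms by simp
  then have "[2 ^ totient c = 1] (mod c)" by (rule euler_theorem)
  then have "[(2 ^ totient c) ^ Suc N = 1 ^ Suc N] (mod c)" by (rule cong_pow)
  then have cong: "[2 ^ (totient c * Suc N) = 1] (mod c)" by (simp only: power_mult power_one)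
  have "0 < totient c" using assms by (simp add: odd_pos)
  then have ge: "Suc N \<le> totient c * Suc N" by (cases "totient c") auto
  define k where "k = totient c * Suc N - 1"
  have k: "Suc k = totient c * Suc N" "N \<le> k" using ge by (auto simp: k_def)
  have "c dvd 2 ^ Suc k - 1"
    using cong unfolding k(1) by (subst cong_to_1_nat) auto
  then show ?thesis using k(2) by blast
qed

text \<open>
  A denominator \<open>b = 2^e * c\<close> with \<open>c\<close> odd divides the value at the end of a block: the slow step
  contributes a Mersenne number divisible by \<open>c\<close>, and the power of 2 there is at least \<open>2^e\<close>.
\<close>

lemma at_most_doubling_slow_seq:
  assumes "2 \<le> K"
  shows "at_most_doubling (slow_seq K)"
proof
  show pos: "0 < slow_seq K i" for i using assms by (rule slow_seq_pos)
  show "slow_seq K (Suc i) \<le> 2 * slow_seq K i" for i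
  proof -
    have "real (slow_seq K (Suc i)) / real (slow_seq K i) \<le> 2" by (simp add: slow_seq_ratio[OF assms])
    then have "real (slow_seq K (Suc i)) \<le> real (2 * slow_seq K i)"
      using pos[of i] by (simp add: field_simps)
    then show ?thesis by (simp only: of_nat_le_iff)
  qed
  show "\<exists>\<^sub>\<infinity>k. slow_seq K (Suc k) < 2 * slow_seq K k"
    unfolding INFM_nat_le
  proof
    fix m
    define i :: nat where "i = 2 ^ (m + K)"
    have "real (slow_seq K (Suc i)) / real (slow_seq K i) < 2"
      using slow_seq_ratio[OF assms, of i] by (auto simp: i_def slow_step_def)
    then have "real (slow_seq K (Suc i)) < real (2 * slow_seq K i)"
      using pos[of i] by (simp add: field_simps)
    then have "slow_seq K (Suc i) < 2 * slow_seq K i" by (simp only: of_nat_less_iff)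
    moreover have "m \<le> i" using less_exp[of "m + K"] unfolding i_def by linarith
    ultimately show "\<exists>n\<ge>m. slow_seq K (Suc n) < 2 * slow_seq K n" by blast
  qed
  show "\<exists>J\<ge>N. b dvd slow_seq K J \<and> (\<forall>i\<le>J. slow_seq K i dvd slow_seq K J)"
    if "0 < b" for b N
  proof -
    obtain e c where b: "b = 2 ^ e * c" "odd c"
    proof (rule multiplicity_decompose'[of b 2])
    qed (use \<open>0 < b\<close> in auto)
    obtain k where k: "k \<ge> N + K + e" "c dvd 2 ^ Suc k - 1" using dvd_mersenne[OF b(2)] by blast
    have "2 ^ e dvd slow_seq K (2 ^ Suc k)"
      using power_dvd_slow_seq[of K "Suc k"] assms k(1)
      by (meson dvd_trans le_imp_power_dvd le_SucI add_leE)
    moreover have "c dvd slow_seq K (2 ^ Suc k)" using slow_seq_block_end[of K k] k by simp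
    moreover have "coprime (2 ^ e) c" using b(2) by simp
    ultimately have "b dvd slow_seq K (2 ^ Suc k)" unfolding b(1) by (simp add: divides_mult)
    moreover have "N \<le> 2 ^ Suc k" using less_exp[of "Suc k"] k(1) by simp
    moreover have "slow_seq K i dvd slow_seq K (2 ^ Suc k)" if "i \<le> 2 ^ Suc k" for i
      using slow_seq_dvd_block_end[of K "Suc k" i] assms k(1) that by simp
    ultimately show ?thesis by blast
  qed
qed

lemma ex_lacunary_covering_rationals:
  fixes lam :: real
  assumes "lam < 2"
  shows "\<exists>n. lacunary lam n \<and>
           {0..2} \<inter> \<rat> \<subseteq> finite_sums (\<lambda>i. 1 / real (n i)) \<and>
           (\<lambda>i. real (n (Suc i)) / real (n i)) \<longlonglongrightarrow> 2 \<and>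
           (\<forall>q \<in> {0<..2} \<inter> \<rat>.
              infinite {T :: nat set. finite T \<and> q = (\<Sum>i\<in>T. 1 / real (n i))})"
proof -
  obtain K0 where K0: "(1/2) ^ K0 < 2 - lam" using real_arch_pow_inv[of "2 - lam" "1/2"] assms by auto
  define K where "K = K0 + 2"
  have K: "2 \<le> K" by (simp add: K_def)
  have lamK: "1 / 2 ^ K \<le> 2 - lam"
  proof -
    have "(1/2::real) ^ K \<le> (1/2) ^ K0" unfolding K_def by (intro power_decreasing) auto
    then show ?thesis using K0 by (simp add: power_one_over)
  qed
  interpret at_most_doubling "slow_seq K" using K by (rule at_most_doubling_slow_seq)
  have "lam \<le> real (slow_seq K (Suc i)) / real (slow_seq K i)" for i
  proof (cases "slow_step K i")
    case True
    then obtain k where k: "K \<le> k" "i = 2 ^ k" unfolding slow_step_def by blast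
    then have "1 / real i \<le> 1 / 2 ^ K"
      by (auto intro!: divide_left_mono power_increasing)
    then show ?thesis using lamK True by (simp add: slow_seq_ratio[OF K])
  qed (use assms in \<open>simp add: slow_seq_ratio[OF K]\<close>)
  then have "lacunary lam (slow_seq K)" using pos by (simp add: lacunary_def)
  moreover have "{0..2} \<inter> \<rat> \<subseteq> finite_sums (\<lambda>i. 1 / real (slow_seq K i))"
    using rational_is_sum by (auto simp: finite_sums_iff)
  moreover have "(\<lambda>i. real (slow_seq K (Suc i)) / real (slow_seq K i)) \<longlonglongrightarrow> 2"
  proof (rule real_tendsto_sandwich)
    have "(\<lambda>i. 2 - 1 / real i) \<longlonglongrightarrow> 2 - 0" by (intro tendsto_diff tendsto_const lim_1_over_n)
    then show "(\<lambda>i. 2 - 1 / real i) \<longlonglongrightarrow> 2" by simp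
    show "(\<lambda>i. 2 :: real) \<longlonglongrightarrow> 2" by simp
  qed (auto simp: slow_seq_ratio[OF K])
  moreover have "\<forall>q \<in> {0<..2} \<inter> \<rat>.
      infinite {T :: nat set. finite T \<and> q = (\<Sum>i\<in>T. 1 / real (slow_seq K i))}"
    using infinitely_many_sums by simp
  ultimately show ?thesis by blast
qed

theorem theorem1:
  shows "(\<forall>lam::real. 1 < lam \<and> lam < 2 \<longrightarrow>
           (\<exists>n :: nat \<Rightarrow> nat. lacunary lam n \<and>
              {0..2} \<inter> \<rat> \<subseteq> finite_sums (\<lambda>i. 1 / real (n i))))
       \<and> (\<forall>lam::real. 1 < lam \<and> lam < 2 \<longrightarrow>
           (\<exists>n :: nat \<Rightarrow> nat. lacunary lam n \<and>
              {0..2} \<inter> \<rat> \<subseteq> finite_sums (\<lambda>i. 1 / real (n i)) \<and>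
              (\<lambda>i. real (n (Suc i)) / real (n i)) \<longlonglongrightarrow> 2 \<and>
              (\<forall>q \<in> {0<..2} \<inter> \<rat>.
                 infinite {T :: nat set. finite T \<and> q = (\<Sum>i\<in>T. 1 / real (n i))})))
       \<and> \<not> (\<exists>n :: nat \<Rightarrow> nat. lacunary 2 n \<and>
              (\<exists>a b :: real. a < b \<and>
                 {a<..<b} \<inter> \<rat> \<subseteq> finite_sums (\<lambda>i. 1 / real (n i))))"
  using ex_lacunary_covering_rationals lacunary_2_no_interval by blast

end
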